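(* Let $V$ be the (finite) set of routers of an Autonomous System, with a distance function $d$ on $V$, and assume all distances are distinct (no ties). For a signaling graph $H$ on vertex set $V$, $H$ is correct if and only if for every ordered pair $(x,y)\in V\times V$ there is a path in $H$ from $y$ to $x$ all of whose vertices lie in $S(x,y)$.
   Context: Model of iBGP: routers form a finite set $V$; $d(x,y)$ is the shortest-path distance between routers $x,y$ in the underlying physical network with positive edge weights. A signaling graph is an arbitrary (overlay) graph $H$ on $V$; its edges join iBGP neighbors. Given a set $X\subseteq V$ of egress routers, each router in $X$ initially knows exactly one route (distinct routers know distinct routes), and that router is the egress router of the route. The protocol runs asynchronously: each router considers the latest routes it has heard from its $H$-neighbors (and its own route, if it is an egress router), chooses the one whose egress router is closest to it according to $d$, and announces its chosen route to its $H$-neighbors; this continues until no router learns of a route whose egress router is closer than that of its current choice. $H$ has the complete visibility property for $X$ if at the end every router $r$ has chosen the route whose egress router is the closest to $r$ among all routers in $X$. $H$ is correct if it has the complete visibility property for every possible set $X$ of egress routers. For $x,y\in V$ define $D(x,y)=\{w\in V: d(x,w)>d(x,y)\}$ and $S(x,y)=\{w\in V: d(w,y)<d(w,D(x,y))\}\cup\{y\}$, where $d(w,A)=\min_{a\in A}d(w,a)$ (taken to be $+\infty$ if $A=\emptyset$). *)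

theory Defs
  imports "Graph_Theory.Graph_Theory"
begin

text \<open>
  Undirected graphs are symmetric arc sets (\<^locale>\<open>pair_graph\<close>). Distances have type
  \<^typ>\<open>ereal\<close>, as does the shortest-path distance of the graph library.
\<close>

definition distinct_distances :: "'v set \<Rightarrow> ('v \<Rightarrow> 'v \<Rightarrow> ereal) \<Rightarrow> bool" where
  "distinct_distances V d \<longleftrightarrow>
     (\<forall>x\<in>V. \<forall>y\<in>V. \<forall>u\<in>V. \<forall>v\<in>V. x \<noteq> y \<and> u \<noteq> v \<and> d x y = d u v \<longrightarrow> {x, y} = {u, v})"

text \<open>The infimum over the empty set is \<^term>\<open>\<infinity> :: ereal\<close>; over a finite nonempty set it is
  the minimum.\<close>

definition dist_to_set :: "('v \<Rightarrow> 'v \<Rightarrow> ereal) \<Rightarrow> 'v \<Rightarrow> 'v set \<Rightarrow> ereal" where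
  "dist_to_set d w A = (INF a\<in>A. d w a)"

definition D_set :: "'v set \<Rightarrow> ('v \<Rightarrow> 'v \<Rightarrow> ereal) \<Rightarrow> 'v \<Rightarrow> 'v \<Rightarrow> 'v set" where
  "D_set V d x y = {w \<in> V. d x w > d x y}"

definition S_set :: "'v set \<Rightarrow> ('v \<Rightarrow> 'v \<Rightarrow> ereal) \<Rightarrow> 'v \<Rightarrow> 'v \<Rightarrow> 'v set" where
  "S_set V d x y = {w \<in> V. d w y < dist_to_set d w (D_set V d x y)} \<union> {y}"

text \<open>
  The protocol. Every egress router has exactly one route and these routes are distinct, so a
  route is identified with its egress router. A message is the sender's newly chosen route, and
  \<^term>\<open>None\<close> stands for ``no route''.

  In a configuration, \<open>choice r\<close> is the current choice of \<open>r\<close>, \<open>heard r n\<close> is the latest route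
  that \<open>r\<close> has received from \<open>n\<close>, and \<open>pending n r\<close> is the first-in-first-out queue of
  announcements sent by \<open>n\<close> and not yet received by \<open>r\<close>.
\<close>

record 'v config =
  choice :: "'v \<Rightarrow> 'v option"
  heard :: "'v \<Rightarrow> 'v \<Rightarrow> 'v option"
  pending :: "'v \<Rightarrow> 'v \<Rightarrow> 'v option list"

datatype 'v event = Receive (sender: 'v) (receiver: 'v) | Decide 'v

definition events :: "'v pair_pre_digraph \<Rightarrow> 'v event set" where
  "events H = {Receive n r | n r. (n, r) \<in> parcs H} \<union> {Decide r | r. r \<in> pverts H}"

definition initial :: "'v config" where
  "initial = \<lparr>choice = (\<lambda>_. None), heard = (\<lambda>_ _. None), pending = (\<lambda>_ _. [])\<rparr>"

definition known_routes :: "'v pair_pre_digraph \<Rightarrow> 'v set \<Rightarrow> 'v config \<Rightarrow> 'v \<Rightarrow> 'v set" where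
  "known_routes H X c r =
     {a. \<exists>n. (n, r) \<in> parcs H \<and> heard c r n = Some a} \<union> (if r \<in> X then {r} else {})"

definition closest :: "('v \<Rightarrow> 'v \<Rightarrow> ereal) \<Rightarrow> 'v \<Rightarrow> 'v set \<Rightarrow> 'v option" where
  "closest d r A = (if A = {} then None else Some (arg_min_on (d r) A))"

text \<open>
  Receiving on an empty queue has no effect. A router that reconsiders its choice sends an
  announcement to its neighbors exactly if the choice has changed.
\<close>

fun exec :: "('v \<Rightarrow> 'v \<Rightarrow> ereal) \<Rightarrow> 'v pair_pre_digraph \<Rightarrow> 'v set \<Rightarrow> 'v event \<Rightarrow> 'v config \<Rightarrow> 'v config"
where
  "exec d H X (Receive n r) c =
     (case pending c n r of
        [] \<Rightarrow> c
      | m # ms \<Rightarrow> c\<lparr>heard := (heard c)(r := (heard c r)(n := m)),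
                    pending := (pending c)(n := (pending c n)(r := ms))\<rparr>)"
| "exec d H X (Decide r) c =
     (let a = closest d r (known_routes H X c r) in
      if a = choice c r then c
      else c\<lparr>choice := (choice c)(r := a),
             pending := (pending c)(r := (\<lambda>n. if (r, n) \<in> parcs H then pending c r n @ [a]
                                              else pending c r n))\<rparr>)"

text \<open>
  An asynchronous execution is determined by the order of its events. Fairness says that no
  announcement is delayed and no router is idle forever; delays are finite but unbounded.
\<close>

definition fair_schedule :: "'v pair_pre_digraph \<Rightarrow> (nat \<Rightarrow> 'v event) \<Rightarrow> bool" where
  "fair_schedule H s \<longleftrightarrow> (\<forall>t. s t \<in> events H) \<and> (\<forall>e\<in>events H. \<exists>\<^sub>\<infinity>t. s t = e)"

primrec run :: "('v \<Rightarrow> 'v \<Rightarrow> ereal) \<Rightarrow> 'v pair_pre_digraph \<Rightarrow> 'v set \<Rightarrow> (nat \<Rightarrow> 'v event) \<Rightarrow>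
  nat \<Rightarrow> 'v config" where
  "run d H X s 0 = initial"
| "run d H X s (Suc t) = exec d H X (s t) (run d H X s t)"

text \<open>The protocol has ended when no event changes the configuration: no announcement is pending
  and no router would revise its choice.\<close>

definition ended :: "('v \<Rightarrow> 'v \<Rightarrow> ereal) \<Rightarrow> 'v pair_pre_digraph \<Rightarrow> 'v set \<Rightarrow> 'v config \<Rightarrow> bool" where
  "ended d H X c \<longleftrightarrow> (\<forall>e\<in>events H. exec d H X e c = c)"

text \<open>
  Executions of the same network may differ in their outcome, and some may not end. Complete
  visibility requires that every fair execution ends, and ends with the right choices. For
  \<open>X = {}\<close> the right choice is to have no route.
\<close>

definition complete_visibility ::
  "('v \<Rightarrow> 'v \<Rightarrow> ereal) \<Rightarrow> 'v pair_pre_digraph \<Rightarrow> 'v set \<Rightarrow> bool" where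
  "complete_visibility d H X \<longleftrightarrow>
     (\<forall>s. fair_schedule H s \<longrightarrow>
        (\<exists>t. ended d H X (run d H X s t) \<and>
             (\<forall>r\<in>pverts H. choice (run d H X s t) r = closest d r X)))"

definition correct :: "('v \<Rightarrow> 'v \<Rightarrow> ereal) \<Rightarrow> 'v pair_pre_digraph \<Rightarrow> bool" where
  "correct d H \<longleftrightarrow> (\<forall>X \<subseteq> pverts H. complete_visibility d H X)"

end

theory Submission
  imports Defs
begin

text \<open>
  For \<open>X = {y} \<union> D(x, y)\<close> the Voronoi cell of \<open>y\<close> is \<open>S(x, y)\<close>, and in general
  \<open>S(r, y)\<close> lies in the cell of \<open>y\<close> whenever \<open>y\<close> is the egress router closest to \<open>r\<close>. So it
  suffices to show that complete visibility for \<open>X\<close> means that \<open>H\<close> is connected inside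
  each Voronoi cell of \<open>X\<close>.

  If the cells are connected, right choices spread along paths inside them and are permanent. For
  the converse, two adjacent routers may keep each other's choice alive without support from its
  egress router, so looking at a final configuration is not enough. Instead, the schedule is chosen
  adversarially: the components of the cells that contain their egress router are made right first,
  and whenever a router becomes right, its whole component is made right before anything else
  happens. Then every component is entirely right or entirely wrong. A wrong component without
  egress router can only be infected from another cell, by a router whose own choice is wrong, so
  some router always remains wrong.
\<close>

section \<open>Executions\<close>

lemma exec_choice:
  "choice (exec d H X e c) r =
     (if e = Decide r then closest d r (known_routes H X c r) else choice c r)"
  by (cases e) (auto simp: Let_def split: list.split)

text \<open>A queue grows only when its sender changes its choice; at all other moments it can only
  shrink.\<close>

lemma exec_pending_not_deciding:
  assumes "e \<noteq> Decide r \<or> closest d r (known_routes H X c r) = choice c r"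
  shows "pending (exec d H X e c) r n =
     (if e = Receive r n then tl (pending c r n) else pending c r n)"
  using assms by (cases e) (auto simp: Let_def split: list.split)

lemma run_eq_fold: "run d H X s t = fold (exec d H X) (map s [0..<t]) initial"
  by (induction t) auto

lemma run_const_after_end:
  assumes "ended d H X (run d H X s t)" "\<And>t. s t \<in> events H" "t \<le> t'"
  shows "run d H X s t' = run d H X s t"
  using assms(3) by (induction rule: dec_induct) (use assms(1,2) in \<open>auto simp: ended_def\<close>)

text \<open>The locale \<open>egress\<close> excludes \<open>X = {}\<close>. In that case no router
  ever learns a route, so the initial configuration is already final.\<close>

lemma complete_visibility_no_egress: "complete_visibility d H {}"
proof -
  have "exec d H {} e initial = initial" for e
    by (cases e) (auto simp: initial_def known_routes_def closest_def)
  then have "ended d H {} (run d H {} s 0)" for s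
    by (simp add: ended_def)
  then show ?thesis
    unfolding complete_visibility_def by (metis closest_def config.select_convs(1) initial_def run.simps(1))
qed

text \<open>Turns an adversary's strategy into a fair schedule: a finite history in \<open>Q\<close>
  is extended forever by blocks containing every event, so each event recurs infinitely often in the
  limit.\<close>

lemma fair_schedule_through:
  assumes start: "Q h0" "set h0 \<subseteq> events H"
    and extend: "\<And>h. Q h \<Longrightarrow> \<exists>h'. set h' = events H \<and> Q (h @ h')"
    and nonempty: "events H \<noteq> {}"
  obtains s where "fair_schedule H s" "\<And>i. \<exists>t\<ge>i. Q (map s [0..<t])"
proof -
  define ext where "ext h g \<longleftrightarrow> (\<exists>h'. set h' = events H \<and> g = h @ h')" for h g :: "'a event list"
  have "\<exists>f. \<forall>n. (Q (f n) \<and> set (f n) \<subseteq> events H) \<and> ext (f n) (f (Suc n))"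
  proof (rule dependent_nat_choice)
    show "\<exists>h. Q h \<and> set h \<subseteq> events H" using start by blast
  next
    fix h assume h: "Q h \<and> set h \<subseteq> events H"
    then obtain h' where h': "set h' = events H" "Q (h @ h')" using extend by blast
    then show "\<exists>g. (Q g \<and> set g \<subseteq> events H) \<and> ext h g"
      using h by (intro exI[of _ "h @ h'"]) (auto simp: ext_def)
  qed
  then obtain f where f: "\<And>n. Q (f n)" "\<And>n. set (f n) \<subseteq> events H" "\<And>n. ext (f n) (f (Suc n))"
    by blast
  have len: "n \<le> length (f n)" for n
  proof (induction n)
    case (Suc n)
    obtain h' where h': "set h' = events H" "f (Suc n) = f n @ h'"
      using f(3)[of n] unfolding ext_def by blast
    have "h' \<noteq> []" using h' nonempty by auto
    then have "length h' > 0" by (rule length_greater_0_conv[THEN iffD2])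
    moreover have "length (f (Suc n)) = length (f n) + length h'" using h' by simp
    ultimately show ?case using Suc by linarith
  qed simp
  have prefix: "\<exists>g. f m = f n @ g" if "n \<le> m" for n m
    using that
  proof (induction rule: dec_induct)
    case (step k)
    then show ?case using f(3)[of k] unfolding ext_def by fastforce
  qed simp
  \<comment> \<open>By \<open>len\<close>, position \<open>t\<close> exists in
    \<open>f (Suc t)\<close>; as the histories are prefixes of one another, every \<open>f n\<close>
    that is long enough agrees there.\<close>
  define s where "s t = f (Suc t) ! t" for t
  have nth: "f n ! t = s t" if "t < length (f n)" for n t
  proof (cases "n \<le> Suc t")
    case True
    then show ?thesis using prefix[OF True] that by (auto simp: s_def nth_append)
  next
    case False
    then have "Suc t \<le> n" by simp
    from prefix[OF this] len[of "Suc t"] show ?thesis by (auto simp: s_def nth_append)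
  qed
  have map_s: "map s [0..<length (f n)] = f n" for n
    by (rule nth_equalityI) (auto simp: nth)
  have "s t \<in> events H" for t
    using f(2)[of "Suc t"] len[of "Suc t"] unfolding s_def
    by (meson Suc_le_eq nth_mem subsetD)
  moreover have "\<exists>\<^sub>\<infinity>t. s t = e" if "e \<in> events H" for e
    unfolding INFM_nat
  proof
    fix m
    obtain h' where h': "set h' = events H" "f (Suc (Suc m)) = f (Suc m) @ h'"
      using f(3)[of "Suc m"] unfolding ext_def by blast
    then have "e \<in> set h'" using \<open>e \<in> events H\<close> by simp
    then obtain i where i: "i < length h'" "h' ! i = e"
      by (auto simp: in_set_conv_nth)
    have "s (length (f (Suc m)) + i) = e"
      using i h' by (subst nth[of _ "Suc (Suc m)", symmetric]) auto
    moreover have "length (f (Suc m)) + i > m" using len[of "Suc m"] by simp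
    ultimately show "\<exists>n>m. s n = e" by blast
  qed
  ultimately have "fair_schedule H s" unfolding fair_schedule_def by blast
  moreover have "\<exists>t\<ge>i. Q (map s [0..<t])" for i
    using len[of i] f(1)[of i] map_s[of i] by (intro exI[of _ "length (f i)"]) simp
  ultimately show ?thesis using that by blast
qed

section \<open>Voronoi cells of the egress routers\<close>

locale egress = pair_graph H for H :: "'v pair_pre_digraph" +
  fixes d :: "'v \<Rightarrow> 'v \<Rightarrow> ereal" and X :: "'v set"
  assumes egress: "X \<subseteq> pverts H" "X \<noteq> {}"
    and inj_dist: "r \<in> pverts H \<Longrightarrow> inj_on (d r) (pverts H)"
    and self_closest: "\<lbrakk>r \<in> pverts H; z \<in> pverts H; r \<noteq> z\<rbrakk> \<Longrightarrow> d r r < d r z"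
begin

abbreviation best :: "'v \<Rightarrow> 'v" where "best r \<equiv> arg_min_on (d r) X"

text \<open>These are the arcs of \<open>H\<close> that stay inside one Voronoi cell; the closure of
  this relation expresses connectivity within cells.\<close>

definition cell_arcs :: "('v \<times> 'v) set" where
  "cell_arcs = {(n, r) \<in> parcs H. best n = best r}"

lemma finite_egress: "finite X"
  using egress(1) pair_finite_verts finite_subset by blast

lemma best_in: "best r \<in> X"
  using arg_min_if_finite(1)[OF finite_egress egress(2)] .

lemma best_le: "z \<in> X \<Longrightarrow> d r (best r) \<le> d r z"
  by (rule arg_min_least[OF finite_egress egress(2)])

text \<open>\<open>arg_min_on\<close> selects some minimizer; injectivity of \<open>d r\<close>
  makes it the only one.\<close>

lemma arg_min_eqI:
  assumes "r \<in> pverts H" "A \<subseteq> X" "y \<in> A" "\<And>z. z \<in> A \<Longrightarrow> d r y \<le> d r z"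
  shows "arg_min_on (d r) A = y"
proof -
  have A: "finite A" "A \<noteq> {}" using assms finite_egress finite_subset by auto
  have "d r (arg_min_on (d r) A) = d r y"
    using arg_min_if_finite(1)[OF A, of "d r"] arg_min_least[OF A assms(3), of "d r"] assms(4)
    by (meson antisym)
  moreover have "arg_min_on (d r) A \<in> pverts H" "y \<in> pverts H"
    using arg_min_if_finite(1)[OF A, of "d r"] assms egress by auto
  ultimately show ?thesis using inj_dist[OF assms(1)] by (meson inj_onD)
qed

lemma best_egress: "u \<in> X \<Longrightarrow> best u = u"
  using egress self_closest by (intro arg_min_eqI) (auto simp: less_imp_le subset_iff intro: le_less[THEN iffD2])

text \<open>The overall nearest egress router stays nearest among any known ones that include it.
  Hence a right choice lasts as long as the route stays known.\<close>

lemma closest_best: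
  assumes "r \<in> pverts H" "A \<subseteq> X" "best r \<in> A"
  shows "closest d r A = Some (best r)"
  using assms best_le by (auto simp: closest_def subset_iff intro!: arg_min_eqI)

lemma closest_in: "closest d r A = Some a \<Longrightarrow> A \<subseteq> X \<Longrightarrow> a \<in> A"
  using arg_min_if_finite(1)[of A "d r"] finite_subset[OF _ finite_egress]
  by (auto simp: closest_def split: if_splits)

lemma cell_arcs_in_verts: "(n, r) \<in> cell_arcs \<Longrightarrow> n \<in> pverts H \<and> r \<in> pverts H"
  by (auto simp: cell_arcs_def dest: in_arcsD1 in_arcsD2)

lemma cell_path_best:
  assumes "(n, r) \<in> cell_arcs\<^sup>*" shows "best n = best r"
  using assms by (induction rule: rtrancl_induct) (auto simp: cell_arcs_def)

subsection \<open>Connected cells suffice\<close>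

definition routes :: "'v option set" where "routes = insert None (Some ` X)"

text \<open>The list \<open>heard c r n # pending c n r\<close> is the channel from \<open>n\<close>
  to \<open>r\<close>, oldest entry first, so the last clause says that its newest entry is
  current.\<close>

definition consistent :: "'v config \<Rightarrow> bool" where
  "consistent c \<longleftrightarrow> (\<forall>r. choice c r \<in> routes) \<and> (\<forall>r n. heard c r n \<in> routes) \<and>
     (\<forall>n r. set (pending c n r) \<subseteq> routes) \<and>
     (\<forall>n r. (n, r) \<in> parcs H \<longrightarrow> last (heard c r n # pending c n r) = choice c n)"

lemma known_routes_egress:
  assumes "consistent c" shows "known_routes H X c r \<subseteq> X"
proof
  fix a assume "a \<in> known_routes H X c r"
  then consider n where "heard c r n = Some a" | "a = r" "r \<in> X"
    by (auto simp: known_routes_def split: if_splits)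
  then show "a \<in> X"
  proof cases
    case 1
    have "heard c r n \<in> routes" using assms by (simp add: consistent_def)
    with 1 show ?thesis by (auto simp: routes_def)
  qed simp
qed

lemma closest_routes: "A \<subseteq> X \<Longrightarrow> closest d r A \<in> routes"
  using closest_in[of r A] by (cases "closest d r A") (auto simp: routes_def)

text \<open>Receiving drops the oldest channel entry, which leaves the newest one in place; deciding
  appends the new choice exactly if it differs from the old one.\<close>

lemma consistent_exec:
  assumes c: "consistent c" shows "consistent (exec d H X e c)"
proof -
  have in_routes: "choice c r \<in> routes" "heard c r n \<in> routes" "x \<in> set (pending c n r) \<Longrightarrow> x \<in> routes"
    for r n x
    using c unfolding consistent_def by blast+
  have fifo: "pending c n r = [] \<Longrightarrow> heard c r n = choice c n"
    "pending c n r \<noteq> [] \<Longrightarrow> last (pending c n r) = choice c n" if "(n, r) \<in> parcs H" for n r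
    using c that unfolding consistent_def by fastforce+
  show ?thesis
  proof (cases e)
    case (Receive n r)
    show ?thesis
    proof (cases "pending c n r")
      case (Cons m ms)
      then have "m \<in> routes" "set ms \<subseteq> routes"
        using in_routes(3)[of _ n r] by auto
      moreover have "last (m # ms) = choice c n" if "(n, r) \<in> parcs H"
        using fifo(2)[OF that] Cons by simp
      ultimately show ?thesis
        using Receive Cons in_routes fifo unfolding consistent_def by auto
    qed (use c Receive in simp)
  next
    case (Decide r)
    then show ?thesis
      using in_routes fifo closest_routes[OF known_routes_egress[OF c], of r r]
      unfolding consistent_def by (auto simp: Let_def)
  qed
qed

lemma consistent_initial: "consistent initial"
  by (auto simp: consistent_def initial_def routes_def)

lemma consistent_run: "consistent (run d H X s t)"
  by (induction t) (auto simp: consistent_initial consistent_exec)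

text \<open>Beyond the right choice, this asks that the choice be supported and fully delivered.
  Thus it passes on to neighbors in the cell, and if it holds everywhere the protocol has
  ended.\<close>

definition settled :: "'v config \<Rightarrow> 'v \<Rightarrow> bool" where
  "settled c r \<longleftrightarrow> best r \<in> known_routes H X c r \<and> choice c r = Some (best r) \<and>
     (\<forall>n. (r, n) \<in> parcs H \<longrightarrow> pending c r n = [] \<and> heard c n r = Some (best r))"

text \<open>Once \<open>best r\<close> is known for good, the next decision of \<open>r\<close> is
  right and final. Its queues then receive nothing new, and fairness drains them.\<close>

lemma eventually_settled:
  assumes fair: "fair_schedule H s" and r: "r \<in> pverts H"
    and known: "\<forall>\<^sub>F t in sequentially. best r \<in> known_routes H X (run d H X s t) r"
  shows "\<forall>\<^sub>F t in sequentially. settled (run d H X s t) r"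
proof -
  let ?c = "run d H X s"
  obtain t0 where t0: "\<And>t. t \<ge> t0 \<Longrightarrow> best r \<in> known_routes H X (?c t) r"
    using known unfolding eventually_sequentially by blast
  have closest_eq: "closest d r (known_routes H X (?c t) r) = Some (best r)" if "t \<ge> t0" for t
    using closest_best[OF r known_routes_egress[OF consistent_run] t0[OF that]] .
  have "Decide r \<in> events H" using r by (auto simp: events_def)
  then obtain td where td: "td > t0" "s td = Decide r"
    using fair unfolding fair_schedule_def INFM_nat by blast
  have choice: "choice (?c t) r = Some (best r)" if "t \<ge> Suc td" for t
    using that
  proof (induction rule: dec_induct)
    case base
    then show ?case using closest_eq[of td] td by (simp add: exec_choice del: exec.simps)
  next
    case (step t)
    then show ?case using closest_eq[of t] td by (simp add: exec_choice del: exec.simps)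
  qed
  have "\<forall>\<^sub>F t in sequentially. pending (?c t) r n = []" if n: "(r, n) \<in> parcs H" for n
  proof -
    let ?q = "\<lambda>t. pending (?c t) r n"
    have next_q: "?q (Suc t) = (if s t = Receive r n then tl (?q t) else ?q t)" if "t \<ge> Suc td" for t
      using choice[OF that] closest_eq[of t] that td by (simp add: exec_pending_not_deciding)
    have dec: "length (?q t') \<le> length (?q t)" if "t' \<ge> t" "t \<ge> Suc td" for t t'
      using that(1)
    proof (induction rule: dec_induct)
      case (step k)
      then show ?case using next_q[of k] that(2) by auto
    qed simp
    \<comment> \<open>Induction on the queue length: a nonempty queue loses an entry at the next
      \<open>Receive r n\<close>, which exists by fairness.\<close>
    have "\<exists>t'\<ge>t. ?q t' = []" if "t \<ge> Suc td" for t
      using that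
    proof (induction "length (?q t)" arbitrary: t rule: less_induct)
      case less
      show ?case
      proof (cases "?q t = []")
        case False
        have "Receive r n \<in> events H" using n by (auto simp: events_def)
        then obtain t1 where t1: "t1 > t" "s t1 = Receive r n"
          using fair unfolding fair_schedule_def INFM_nat by blast
        have "length (?q (Suc t1)) = length (?q t1) - 1"
          using next_q[of t1] t1 less.prems by simp
        moreover have "length (?q t1) \<le> length (?q t)"
          using dec[of t t1] t1 less.prems by simp
        moreover have "length (?q t) > 0" using False by (rule length_greater_0_conv[THEN iffD2])
        ultimately have "length (?q (Suc t1)) < length (?q t)" by linarith
        moreover have "Suc t1 \<ge> Suc td" using t1 less.prems by simp
        ultimately obtain t' where "t' \<ge> Suc t1" "?q t' = []" using less.hyps by blast
        then show ?thesis using t1 by (intro exI[of _ t']) simp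
      qed blast
    qed
    then obtain t' where t': "t' \<ge> Suc td" "?q t' = []" by blast
    have "?q t = []" if "t \<ge> t'" for t
      using dec[OF that t'(1)] t'(2) by simp
    then show ?thesis unfolding eventually_sequentially by blast
  qed
  then have "\<forall>\<^sub>F t in sequentially. \<forall>n\<in>pverts H. (r, n) \<in> parcs H \<longrightarrow> pending (?c t) r n = []"
    by (intro eventually_ball_finite[OF pair_finite_verts]) auto
  moreover have "\<forall>\<^sub>F t in sequentially. choice (?c t) r = Some (best r)"
    using choice unfolding eventually_sequentially by blast
  ultimately show ?thesis
    using known
  proof eventually_elim
    case (elim t)
    have "pending (?c t) r n = [] \<and> heard (?c t) n r = Some (best r)" if n: "(r, n) \<in> parcs H" for n
    proof -
      have "pending (?c t) r n = []" using elim(1) n in_arcsD2 by blast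
      \<comment> \<open>With an empty queue, the newest channel entry is the heard route
        itself.\<close>
      moreover have "last (heard (?c t) n r # pending (?c t) r n) = choice (?c t) r"
        using consistent_run[of s t] n unfolding consistent_def by blast
      ultimately show ?thesis using elim(2) by simp
    qed
    then show ?case using elim by (auto simp: settled_def)
  qed
qed

text \<open>Induction along the path: an egress router always knows its own route, and a settled
  router keeps its cell neighbors informed of the route that is best for them too.\<close>

lemma settled_along_cell:
  assumes fair: "fair_schedule H s" and "(u, r) \<in> cell_arcs\<^sup>*" "u \<in> X"
  shows "\<forall>\<^sub>F t in sequentially. settled (run d H X s t) r"
  using assms(2)
proof (induction rule: rtrancl_induct)
  case base
  have "best u \<in> known_routes H X c u" for c
    using best_egress[OF assms(3)] assms(3) by (simp add: known_routes_def)
  then show ?case using eventually_settled[OF fair, of u] assms(3) egress by auto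
next
  case (step n m)
  have arc: "(n, m) \<in> parcs H" "best n = best m" using step(2) by (auto simp: cell_arcs_def)
  from step.IH have "\<forall>\<^sub>F t in sequentially. best m \<in> known_routes H X (run d H X s t) m"
  proof eventually_elim
    case (elim t)
    then show ?case using arc by (auto simp: settled_def known_routes_def)
  qed
  then show ?case using eventually_settled[OF fair] arc in_arcsD2 by blast
qed

text \<open>As there are finitely many routers, all are settled at a common time; then all queues
  are empty and no decision changes anything.\<close>

lemma complete_visibility_if_cells_connected:
  assumes "\<And>r. r \<in> pverts H \<Longrightarrow> (best r, r) \<in> cell_arcs\<^sup>*"
  shows "complete_visibility d H X"
  unfolding complete_visibility_def
proof (intro allI impI)
  fix s assume fair: "fair_schedule H s"
  have "\<forall>\<^sub>F t in sequentially. \<forall>r\<in>pverts H. settled (run d H X s t) r"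
    using settled_along_cell[OF fair assms best_in] pair_finite_verts
    by (intro eventually_ball_finite) auto
  then obtain t where t: "\<And>r. r \<in> pverts H \<Longrightarrow> settled (run d H X s t) r"
    unfolding eventually_sequentially by blast
  let ?c = "run d H X s t"
  have "exec d H X e ?c = ?c" if "e \<in> events H" for e
  proof -
    from that consider n r where "e = Receive n r" "(n, r) \<in> parcs H"
      | r where "e = Decide r" "r \<in> pverts H"
      by (auto simp: events_def)
    then show ?thesis
    proof cases
      case 1
      then have "pending ?c n r = []" using t[of n] in_arcsD1 by (auto simp: settled_def)
      then show ?thesis using 1 by simp
    next
      case 2
      then have "closest d r (known_routes H X ?c r) = choice ?c r"
        using t[of r] closest_best[OF _ known_routes_egress[OF consistent_run]]
        by (auto simp: settled_def)
      then show ?thesis using 2 by simp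
    qed
  qed
  then have "ended d H X ?c" by (simp add: ended_def)
  moreover have "choice ?c r = closest d r X" if "r \<in> pverts H" for r
    using t[OF that] closest_best[OF that subset_refl best_in] by (simp add: settled_def)
  ultimately show "\<exists>t. ended d H X (run d H X s t) \<and>
      (\<forall>r\<in>pverts H. choice (run d H X s t) r = closest d r X)" by blast
qed

subsection \<open>Connected cells are necessary\<close>

text \<open>An idealized decision without queues, in which \<open>r\<close> reads its neighbors'
  current choices directly.\<close>

definition update :: "'v \<Rightarrow> ('v \<Rightarrow> 'v option) \<Rightarrow> 'v \<Rightarrow> 'v option" where
  "update r f = f(r := closest d r
     ({a. \<exists>n. (n, r) \<in> parcs H \<and> f n = Some a} \<union> (if r \<in> X then {r} else {})))"

text \<open>For \<^term>\<open>M = {}\<close> all announcements have been received.\<close>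

definition undelivered :: "'v \<Rightarrow> 'v set \<Rightarrow> 'v config \<Rightarrow> bool" where
  "undelivered r M c \<longleftrightarrow> (\<forall>(m, k)\<in>parcs H.
     if m = r \<and> k \<in> M then pending c m k = [choice c m]
     else pending c m k = [] \<and> heard c k m = choice c m)"

text \<open>The router decides and all its neighbors receive at once, in an arbitrary order; if
  nothing was announced, receiving has no effect.\<close>

definition activation :: "'v \<Rightarrow> 'v event list" where
  "activation r = Decide r # map (Receive r) (SOME ns. set ns = {n. (r, n) \<in> parcs H})"

lemma set_activation:
  "set (activation r) = insert (Decide r) {Receive r n | n. (r, n) \<in> parcs H}"
proof -
  have "{n. (r, n) \<in> parcs H} \<subseteq> pverts H" using in_arcsD2 by blast
  then have "finite {n. (r, n) \<in> parcs H}" using pair_finite_verts finite_subset by blast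
  then have "\<exists>ns. set ns = {n. (r, n) \<in> parcs H}" by (rule finite_list)
  then have "set (SOME ns. set ns = {n. (r, n) \<in> parcs H}) = {n. (r, n) \<in> parcs H}"
    by (rule someI_ex)
  then show ?thesis unfolding activation_def by auto
qed

lemma undelivered_receive:
  assumes "undelivered r M c"
  shows "undelivered r (M - {n}) (exec d H X (Receive r n) c)"
  unfolding undelivered_def
proof clarify
  fix m k assume mk: "(m, k) \<in> parcs H"
  then have "if m = r \<and> k \<in> M then pending c m k = [choice c m]
     else pending c m k = [] \<and> heard c k m = choice c m"
    using assms by (auto simp: undelivered_def)
  then show "if m = r \<and> k \<in> M - {n}
     then pending (exec d H X (Receive r n) c) m k = [choice (exec d H X (Receive r n) c) m]
     else pending (exec d H X (Receive r n) c) m k = [] \<and>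
       heard (exec d H X (Receive r n) c) k m = choice (exec d H X (Receive r n) c) m"
    by (cases "pending c r n") (auto split: if_splits)
qed

lemma undelivered_receive_all:
  assumes "undelivered r M c"
  shows "undelivered r (M - set ns) (fold (exec d H X) (map (Receive r) ns) c) \<and>
    choice (fold (exec d H X) (map (Receive r) ns) c) = choice c"
  using assms
proof (induction ns arbitrary: M c)
  case (Cons n ns)
  have "M - {n} - set ns = M - set (n # ns)" by auto
  moreover have "choice (exec d H X (Receive r n) c) = choice c"
    by (rule ext) (simp only: exec_choice event.distinct if_False)
  ultimately show ?case
    using Cons.IH[OF undelivered_receive[OF Cons.prems, of n]]
    by (simp del: exec.simps)
qed simp

lemma undelivered_empty_cong: "undelivered r {} c \<Longrightarrow> undelivered r' {} c"
  by (simp add: undelivered_def)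

text \<open>With all announcements delivered, heard routes are current choices, so the decision
  agrees with \<open>update\<close>; the receptions then empty the queues again.\<close>

lemma activation_update:
  assumes "undelivered r' {} c"
  shows "undelivered r' {} (fold (exec d H X) (activation r) c) \<and>
    choice (fold (exec d H X) (activation r) c) = update r (choice c)"
proof -
  define ns where "ns = (SOME ns. set ns = {n. (r, n) \<in> parcs H})"
  have ns: "set ns = {n. (r, n) \<in> parcs H}"
    using set_activation[of r] unfolding activation_def ns_def by fastforce
  let ?c = "exec d H X (Decide r) c"
  have "known_routes H X c r =
      {a. \<exists>n. (n, r) \<in> parcs H \<and> choice c n = Some a} \<union> (if r \<in> X then {r} else {})"
    using assms by (fastforce simp: known_routes_def undelivered_def)
  then have choice: "choice ?c = update r (choice c)"
    by (intro ext) (simp add: exec_choice update_def del: exec.simps)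
  \<comment> \<open>\<open>M\<close> is empty if the choice of \<open>r\<close> is unchanged, and
    otherwise consists of all neighbors of \<open>r\<close>.\<close>
  obtain M where M: "undelivered r M ?c" "M \<subseteq> set ns"
  proof (cases "closest d r (known_routes H X c r) = choice c r")
    case True
    then show ?thesis
      using that[of "{}"] undelivered_empty_cong[OF assms] by simp
  next
    case False
    then have "undelivered r (set ns) ?c"
      using assms by (auto simp: undelivered_def Let_def ns)
    then show ?thesis using that by blast
  qed
  then have "M - set ns = {}" by blast
  with undelivered_receive_all[OF M(1), of ns] choice
  show ?thesis
    by (auto simp: activation_def ns_def[symmetric] simp del: exec.simps intro: undelivered_empty_cong)
qed

lemma activations_update:
  assumes "undelivered r {} c"
  shows "undelivered r {} (fold (exec d H X) (concat (map activation rs)) c) \<and>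
    choice (fold (exec d H X) (concat (map activation rs)) c) = fold update rs (choice c)"
  using assms
proof (induction rs arbitrary: c)
  case (Cons a rs)
  then show ?case using activation_update[OF Cons.prems, of a] by simp
qed simp

lemma set_activations_subset:
  "set rs \<subseteq> pverts H \<Longrightarrow> set (concat (map activation rs)) \<subseteq> events H"
  using set_activation by (fastforce simp: events_def)

text \<open>Each \<open>Receive n r\<close> occurs in the activation of its sender \<open>n\<close>,
  so a round over all routers is a block as required by
  \<open>fair_schedule_through\<close>.\<close>

lemma set_activations:
  assumes "set rs = pverts H"
  shows "set (concat (map activation rs)) = events H"
proof
  show "events H \<subseteq> set (concat (map activation rs))"
  proof
    fix e assume "e \<in> events H"
    then consider n r where "e = Receive n r" "(n, r) \<in> parcs H" | r where "e = Decide r" "r \<in> pverts H"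
      by (auto simp: events_def)
    then show "e \<in> set (concat (map activation rs))"
    proof cases
      case 1
      then have "n \<in> set rs" "e \<in> set (activation n)"
        using assms in_arcsD1 set_activation by auto
      then show ?thesis by auto
    next
      case 2
      then have "r \<in> set rs" "e \<in> set (activation r)"
        using assms set_activation by auto
      then show ?thesis by auto
    qed
  qed
qed (use assms set_activations_subset in blast)

section \<open>Spreading right choices inside cells\<close>

definition right :: "('v \<Rightarrow> 'v option) \<Rightarrow> 'v set" where
  "right f = {r \<in> pverts H. f r = Some (best r)}"

lemma update_known_subset:
  assumes "range f \<subseteq> routes"
  shows "{a. \<exists>n. (n, r) \<in> parcs H \<and> f n = Some a} \<union> (if r \<in> X then {r} else {}) \<subseteq> X"
proof -
  have "a \<in> X" if "f n = Some a" for n a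
    using assms that by (auto simp: routes_def dest: subsetD[OF _ rangeI[of f n]])
  then show ?thesis by auto
qed

lemma update_routes: "range f \<subseteq> routes \<Longrightarrow> range (update r f) \<subseteq> routes"
  using closest_routes[OF update_known_subset] unfolding update_def by fastforce

lemma update_rightI:
  assumes "range f \<subseteq> routes" "r \<in> pverts H"
    "r \<in> X \<or> (\<exists>n\<in>right f. (n, r) \<in> cell_arcs)"
  shows "update r f r = Some (best r)"
  unfolding update_def fun_upd_same
proof (rule closest_best[OF assms(2) update_known_subset[OF assms(1)]])
  show "best r \<in> {a. \<exists>n. (n, r) \<in> parcs H \<and> f n = Some a} \<union> (if r \<in> X then {r} else {})"
    using assms(3) best_egress by (auto simp: right_def cell_arcs_def)
qed

lemma right_update:
  assumes "r \<in> pverts H"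
  shows "right (update r f) =
    (if update r f r = Some (best r) then insert r (right f) else right f - {r})"
  using assms by (auto simp: right_def) (auto simp: update_def split: if_splits)

text \<open>Activating a wrong cell neighbor of a right router makes it right and harms no other, so
  the number of wrong routers drops. The closed bound \<open>S\<close> serves to certify that some
  router stays wrong.\<close>

lemma saturate:
  assumes "range f \<subseteq> routes" "right f \<subseteq> S" "cell_arcs `` S \<subseteq> S"
  shows "\<exists>rs. set rs \<subseteq> pverts H \<and> range (fold update rs f) \<subseteq> routes \<and>
    right f \<subseteq> right (fold update rs f) \<and> right (fold update rs f) \<subseteq> S \<and>
    cell_arcs `` right (fold update rs f) \<subseteq> right (fold update rs f)"
  using assms(1,2)
proof (induction "card (pverts H - right f)" arbitrary: f rule: less_induct)
  case less
  show ?case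
  proof (cases "cell_arcs `` right f \<subseteq> right f")
    case True
    then show ?thesis using less.prems by (intro exI[of _ "[]"]) simp
  next
    case False
    then obtain n m where nm: "(n, m) \<in> cell_arcs" "n \<in> right f" "m \<notin> right f" by blast
    then have m: "m \<in> pverts H" "m \<in> S"
      using cell_arcs_in_verts less.prems(2) assms(3) by blast+
    let ?g = "update m f"
    have right_g: "right ?g = insert m (right f)"
      using right_update[OF m(1)] update_rightI[OF less.prems(1) m(1)] nm by auto
    have "pverts H - right ?g \<subset> pverts H - right f" using right_g m nm by blast
    then have "card (pverts H - right ?g) < card (pverts H - right f)"
      by (intro psubset_card_mono) (use pair_finite_verts in auto)
    moreover have "right ?g \<subseteq> S" using right_g m less.prems(2) by simp
    ultimately obtain rs where "set rs \<subseteq> pverts H" "range (fold update rs ?g) \<subseteq> routes"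
      "right ?g \<subseteq> right (fold update rs ?g)" "right (fold update rs ?g) \<subseteq> S"
      "cell_arcs `` right (fold update rs ?g) \<subseteq> right (fold update rs ?g)"
      using less.hyps[OF _ update_routes[OF less.prems(1)], of m] by blast
    then show ?thesis using right_g m by (intro exI[of _ "m # rs"]) auto
  qed
qed

text \<open>As arcs are symmetric, closure under \<open>cell_arcs\<close> means that each component
  of a cell is entirely right or entirely wrong.\<close>

definition checkpoint :: "('v \<Rightarrow> 'v option) \<Rightarrow> bool" where
  "checkpoint f \<longleftrightarrow> range f \<subseteq> routes \<and> X \<subseteq> right f \<and> cell_arcs `` right f \<subseteq> right f \<and>
     right f \<noteq> pverts H"

lemma cell_arcs_sym: "(n, r) \<in> cell_arcs \<Longrightarrow> (r, n) \<in> cell_arcs"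
  using arcs_symmetric by (auto simp: cell_arcs_def)

text \<open>In each case some router stays wrong: \<open>r\<close> itself, an old wrong router, or
  the neighbor from which \<open>r\<close> learned its route.\<close>

lemma checkpoint_step:
  assumes f: "checkpoint f" and r: "r \<in> pverts H"
  shows "\<exists>rs. set rs \<subseteq> pverts H \<and> r \<in> set rs \<and> checkpoint (fold update rs f)"
proof -
  note f' = f[unfolded checkpoint_def]
  have routes_f: "range f \<subseteq> routes" and X_f: "X \<subseteq> right f"
    and closed_f: "cell_arcs `` right f \<subseteq> right f" and wrong_f: "right f \<noteq> pverts H"
    using f' by blast+
  let ?g = "update r f"
  consider (wrong) "?g r \<noteq> Some (best r)" | (kept) "?g r = Some (best r)" "r \<in> right f"
    | (gained) "?g r = Some (best r)" "r \<notin> right f" by blast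
  then show ?thesis
  proof cases
    case wrong
    then have right_g: "right ?g = right f - {r}" using right_update[OF r] by simp
    \<comment> \<open>A right neighbor in the same cell would have made \<open>r\<close> right. So
      no right router leads to \<open>r\<close>, and removing \<open>r\<close> keeps the right set
      closed.\<close>
    have no_arc: "(n, r) \<notin> cell_arcs" if "n \<in> right f" for n
      using update_rightI[OF routes_f r] wrong that by blast
    have "r \<notin> X" using update_rightI[OF routes_f r] wrong by blast
    then have "X \<subseteq> right ?g" using X_f right_g by auto
    moreover have "cell_arcs `` right ?g \<subseteq> right ?g"
    proof clarify
      fix n m assume "n \<in> right ?g" "(n, m) \<in> cell_arcs"
      then have "n \<in> right f" "m \<noteq> r" using right_g no_arc[of n] by auto
      then show "m \<in> right ?g" using closed_f right_g \<open>(n, m) \<in> cell_arcs\<close> by auto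
    qed
    moreover have "r \<notin> right ?g" using right_g by simp
    ultimately have "checkpoint ?g"
      unfolding checkpoint_def using update_routes[OF routes_f, of r] r by auto
    then show ?thesis using r by (intro exI[of _ "[r]"]) simp
  next
    case kept
    then have "f r = ?g r" by (simp add: right_def)
    then have "?g = f" unfolding update_def by (metis fun_upd_same fun_upd_triv)
    then show ?thesis using f r by (intro exI[of _ "[r]"]) simp
  next
    case gained
    have right_g: "right ?g = insert r (right f)" using right_update[OF r] gained by simp
    have "r \<notin> X" using gained X_f by blast
    obtain n where n: "(n, r) \<in> parcs H" "f n = Some (best r)"
      using closest_in[OF gained(1)[unfolded update_def fun_upd_same] update_known_subset[OF routes_f]]
        \<open>r \<notin> X\<close> by auto
    have n_verts: "n \<in> pverts H" using n in_arcsD1 by blast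
    \<comment> \<open>The neighbor that infects the component of \<open>r\<close> lies in another cell, hence is wrong, and
      saturating the cell of \<open>r\<close> leaves it wrong.\<close>
    have n_cell: "best n \<noteq> best r"
    proof
      assume "best n = best r"
      then have "n \<in> right f" "(n, r) \<in> cell_arcs"
        using n n_verts by (auto simp: right_def cell_arcs_def)
      then show False using closed_f gained by blast
    qed
    \<comment> \<open>Taking the whole cell of \<open>r\<close> makes \<open>S\<close> closed;
      \<open>n\<close> is outside, being in another cell and wrong since it chose
      \<open>best r\<close>.\<close>
    define S where "S = right f \<union> {k \<in> pverts H. best k = best r}"
    have "n \<notin> S" using n n_cell by (auto simp: S_def right_def)
    have "cell_arcs `` S \<subseteq> S"
    proof clarify
      fix a b assume ab: "a \<in> S" "(a, b) \<in> cell_arcs"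
      then have "b \<in> pverts H" "best a = best b" using cell_arcs_in_verts by (auto simp: cell_arcs_def)
      then show "b \<in> S" using ab closed_f by (auto simp: S_def)
    qed
    moreover have "right ?g \<subseteq> S" using right_g r by (auto simp: S_def)
    ultimately obtain rs where rs: "set rs \<subseteq> pverts H" "range (fold update rs ?g) \<subseteq> routes"
      "right ?g \<subseteq> right (fold update rs ?g)" "right (fold update rs ?g) \<subseteq> S"
      "cell_arcs `` right (fold update rs ?g) \<subseteq> right (fold update rs ?g)"
      using saturate[OF update_routes[OF routes_f, of r], of S] by blast
    have "X \<subseteq> right (fold update rs ?g)" using rs(3) right_g X_f by auto
    moreover have "right (fold update rs ?g) \<noteq> pverts H"
      using rs(4) \<open>n \<notin> S\<close> n_verts by auto
    ultimately have "checkpoint (fold update rs ?g)"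
      unfolding checkpoint_def using rs(2,5) by simp
    then show ?thesis using rs(1) r by (intro exI[of _ "r # rs"]) simp
  qed
qed

lemma checkpoint_steps:
  assumes "checkpoint f" "set vs \<subseteq> pverts H"
  shows "\<exists>rs. set rs \<subseteq> pverts H \<and> set vs \<subseteq> set rs \<and> checkpoint (fold update rs f)"
  using assms
proof (induction vs arbitrary: f)
  case Nil
  then show ?case by (intro exI[of _ "[]"]) simp
next
  case (Cons v vs)
  then obtain rs where rs: "set rs \<subseteq> pverts H" "v \<in> set rs" "checkpoint (fold update rs f)"
    using checkpoint_step[of f v] by auto
  then obtain rs' where "set rs' \<subseteq> pverts H" "set vs \<subseteq> set rs'"
    "checkpoint (fold update rs' (fold update rs f))"
    using Cons.IH[of "fold update rs f"] Cons.prems by auto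
  then show ?case using rs by (intro exI[of _ "rs @ rs'"]) auto
qed

lemma checkpoint_round:
  assumes "checkpoint f"
  shows "\<exists>rs. set rs = pverts H \<and> checkpoint (fold update rs f)"
proof -
  obtain vs where "set vs = pverts H" using finite_list[OF pair_finite_verts] by blast
  then show ?thesis using checkpoint_steps[OF assms, of vs] by blast
qed

lemma update_egress:
  assumes "range f \<subseteq> routes" "set us \<subseteq> X" "right f \<subseteq> S" "X \<subseteq> S"
  shows "range (fold update us f) \<subseteq> routes \<and> right (fold update us f) \<subseteq> S \<and>
    right f \<union> set us \<subseteq> right (fold update us f)"
  using assms
proof (induction us arbitrary: f)
  case (Cons u us)
  have u: "u \<in> X" "u \<in> pverts H" using Cons.prems egress by auto
  have right_u: "right (update u f) = insert u (right f)"
    using right_update[OF u(2)] update_rightI[OF Cons.prems(1) u(2)] u by simp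
  then have "right (update u f) \<subseteq> S" "set us \<subseteq> X" using Cons.prems u by auto
  then show ?case
    using Cons.IH[OF update_routes[OF Cons.prems(1), of u]] Cons.prems(4)
    unfolding right_u fold_simps list.set by blast
qed simp

text \<open>The egress routers are activated first and their components saturated; everything right
  then lies in the part reachable from \<open>X\<close> within cells, which omits
  \<open>b\<close>.\<close>

lemma checkpoint_reachable:
  assumes b: "b \<in> pverts H" "b \<notin> cell_arcs\<^sup>* `` X"
  shows "\<exists>rs. set rs \<subseteq> pverts H \<and> checkpoint (fold update rs (\<lambda>_. None))"
proof -
  let ?S = "cell_arcs\<^sup>* `` X"
  obtain us where us: "set us = X" using finite_list[OF finite_egress] by blast
  let ?f = "fold update us (\<lambda>_. None)"
  have f: "range ?f \<subseteq> routes" "right ?f \<subseteq> ?S" "X \<subseteq> right ?f"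
    using update_egress[of "\<lambda>_. None" us ?S] us by (auto simp: routes_def right_def)
  have "cell_arcs `` ?S \<subseteq> ?S" by (auto intro: rtrancl_into_rtrancl)
  from saturate[OF f(1,2) this]
  obtain rs where "set rs \<subseteq> pverts H" "range (fold update rs ?f) \<subseteq> routes"
    "right ?f \<subseteq> right (fold update rs ?f)" "right (fold update rs ?f) \<subseteq> ?S"
    "cell_arcs `` right (fold update rs ?f) \<subseteq> right (fold update rs ?f)" by blast
  then have "checkpoint (fold update (us @ rs) (\<lambda>_. None))" "set (us @ rs) \<subseteq> pverts H"
    using f b us egress unfolding checkpoint_def by auto
  then show ?thesis by blast
qed

lemma cells_connected_if_complete_visibility:
  assumes visible: "complete_visibility d H X" and b: "b \<in> pverts H"
  shows "(best b, b) \<in> cell_arcs\<^sup>*"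
proof (rule ccontr)
  assume unreachable: "(best b, b) \<notin> cell_arcs\<^sup>*"
  \<comment> \<open>Paths inside cells preserve \<open>best\<close>, so an egress router leading to
    \<open>b\<close> could only be \<open>best b\<close>.\<close>
  have "b \<notin> cell_arcs\<^sup>* `` X"
  proof
    assume "b \<in> cell_arcs\<^sup>* `` X"
    then obtain u where "u \<in> X" "(u, b) \<in> cell_arcs\<^sup>*" by blast
    then show False using cell_path_best[of u b] best_egress[of u] unreachable by simp
  qed
  then obtain rs0 where rs0: "set rs0 \<subseteq> pverts H" "checkpoint (fold update rs0 (\<lambda>_. None))"
    using checkpoint_reachable[OF b] by blast
  define Q where "Q h \<longleftrightarrow>
    (\<exists>rs. h = concat (map activation rs) \<and> checkpoint (fold update rs (\<lambda>_. None)))" for h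
  have "\<exists>h'. set h' = events H \<and> Q (h @ h')" if Q: "Q h" for h
  proof -
    obtain rs where rs: "h = concat (map activation rs)" "checkpoint (fold update rs (\<lambda>_. None))"
      using Q by (auto simp: Q_def)
    obtain rs' where rs': "set rs' = pverts H"
      "checkpoint (fold update rs' (fold update rs (\<lambda>_. None)))"
      using checkpoint_round[OF rs(2)] by blast
    have "Q (h @ concat (map activation rs'))"
      unfolding Q_def using rs rs' by (intro exI[of _ "rs @ rs'"]) simp
    then show ?thesis using set_activations[OF rs'(1)] by blast
  qed
  moreover have "Q (concat (map activation rs0))" using rs0 by (auto simp: Q_def)
  moreover have "set (concat (map activation rs0)) \<subseteq> events H"
    using set_activations_subset rs0 by blast
  moreover have "events H \<noteq> {}" using b by (auto simp: events_def)
  ultimately obtain s where s: "fair_schedule H s" "\<And>i. \<exists>t\<ge>i. Q (map s [0..<t])"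
    using fair_schedule_through[of Q "concat (map activation rs0)" H] by blast
  obtain t where t: "ended d H X (run d H X s t)"
    "\<And>r. r \<in> pverts H \<Longrightarrow> choice (run d H X s t) r = closest d r X"
    using visible s(1) unfolding complete_visibility_def by blast
  \<comment> \<open>A checkpoint occurs after the supposed end, when the configuration can no longer
    change; its wrong router contradicts the right outcome.\<close>
  obtain t' rs where t': "t' \<ge> t" "map s [0..<t'] = concat (map activation rs)"
    "checkpoint (fold update rs (\<lambda>_. None))"
    using s(2)[of t] unfolding Q_def by blast
  have "undelivered b {} initial" by (simp add: undelivered_def initial_def)
  then have "choice (run d H X s t') = fold update rs (\<lambda>_. None)"
    using activations_update[of b initial rs] t'(2) by (simp add: run_eq_fold initial_def)
  moreover have "run d H X s t' = run d H X s t"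
    using run_const_after_end[OF t(1) _ t'(1)] s(1) by (auto simp: fair_schedule_def)
  ultimately have "fold update rs (\<lambda>_. None) r = Some (best r)" if "r \<in> pverts H" for r
    using t(2)[OF that] closest_best[OF that subset_refl best_in] by simp
  then have "right (fold update rs (\<lambda>_. None)) = pverts H" by (auto simp: right_def)
  then show False using t'(3) by (simp add: checkpoint_def)
qed

end

section \<open>Signaling paths and cells\<close>

text \<open>A walk confined to \<open>S\<close> shortens to a path using only arcs of the walk. The
  conjunct \<open>y \<in> S\<close> covers the empty path, since the closure is reflexive outside
  \<open>S\<close> too.\<close>

lemma (in pair_wf_digraph) apath_in_set_iff:
  assumes "y \<in> pverts G"
  shows "(\<exists>p. apath y p x \<and> set (awalk_verts y p) \<subseteq> S) \<longleftrightarrow>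
    y \<in> S \<and> (y, x) \<in> {(u, v) \<in> parcs G. u \<in> S \<and> v \<in> S}\<^sup>*" (is "?L \<longleftrightarrow> ?R")
proof
  have walk: "(u, x) \<in> {(u, v) \<in> parcs G. u \<in> S \<and> v \<in> S}\<^sup>*"
    if "awalk u p x" "set (awalk_verts u p) \<subseteq> S" for u p
    using that
  proof (induction p arbitrary: u)
    case (Cons e p)
    obtain a b where e: "e = (a, b)" by fastforce
    have step: "a = u" "(u, b) \<in> parcs G" "awalk b p x"
      using Cons.prems e by (auto simp: awalk_Cons_iff)
    have "set (awalk_verts b p) \<subseteq> S" "u \<in> S" using Cons.prems e step by auto
    moreover have "b \<in> set (awalk_verts b p)" using step(3) by (rule hd_in_awalk_verts(1))
    ultimately show ?case
      using Cons.IH[OF step(3)] step by (auto intro: converse_rtrancl_into_rtrancl)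
  qed (auto simp: awalk_Nil_iff)
  assume ?L
  then obtain p where p: "apath y p x" "set (awalk_verts y p) \<subseteq> S" by blast
  moreover from p(1) have "awalk y p x" "y \<in> set (awalk_verts y p)"
    by (rule awalkI_apath, rule hd_in_awalk_verts(2))
  ultimately show ?R using walk p by blast
next
  assume R: ?R
  then have "(y, x) \<in> {(u, v) \<in> parcs G. u \<in> S \<and> v \<in> S}\<^sup>*" by blast
  then have "\<exists>p. awalk y p x \<and> set (awalk_verts y p) \<subseteq> S"
  proof (induction rule: rtrancl_induct)
    case base
    then show ?case using assms R by (intro exI[of _ "[]"]) (simp add: awalk_Nil_iff)
  next
    case (step u v)
    then obtain p where p: "awalk y p u" "set (awalk_verts y p) \<subseteq> S" by blast
    have "awalk u [(u, v)] v" using step(2) by (auto simp: awalk_simps dest: in_arcsD1 in_arcsD2)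
    then have "awalk y (p @ [(u, v)]) v" using p by (auto intro: awalk_appendI)
    moreover from this have "set (awalk_verts y (p @ [(u, v)])) \<subseteq> S"
      using p step(2) by (auto simp: set_awalk_verts)
    ultimately show ?case by blast
  qed
  then obtain p where p: "awalk y p x" "set (awalk_verts y p) \<subseteq> S" by blast
  have path: "apath y (awalk_to_apath p) x" by (rule apath_awalk_to_apath[OF p(1)])
  have "set (awalk_verts y (awalk_to_apath p)) \<subseteq> set (awalk_verts y p)"
    using awalk_to_apath_subset[OF p(1)]
    unfolding set_awalk_verts[OF p(1)] set_awalk_verts[OF awalkI_apath[OF path]] by auto
  with path p(2) show ?L by blast
qed

lemma (in egress) cell_eq_S_set:
  assumes y: "y \<in> pverts H" and X: "X = insert y (D_set (pverts H) d x y)"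
    and finite_dist: "\<And>w. w \<in> pverts H \<Longrightarrow> d w y < \<infinity>"
  shows "S_set (pverts H) d x y = {w \<in> pverts H. best w = y}"
proof -
  let ?D = "D_set (pverts H) d x y"
  have yD: "y \<notin> ?D" by (simp add: D_set_def)
  have D: "?D \<subseteq> pverts H" by (auto simp: D_set_def)
  then have fin: "finite ?D" using pair_finite_verts finite_subset by blast
  have less_iff: "d w y < dist_to_set d w ?D \<longleftrightarrow> (\<forall>z\<in>?D. d w y < d w z)" if "w \<in> pverts H" for w
  proof (cases "?D = {}")
    \<comment> \<open>The infimum over the empty set is infinite, so the comparison holds because
      \<open>d w y\<close> is finite.\<close>
    case True
    then show ?thesis using finite_dist[OF that] by (simp add: dist_to_set_def top_ereal_def)
  next
    case False
    then show ?thesis unfolding dist_to_set_def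
      using fin by (subst finite_less_Inf_iff) auto
  qed
  have "best w = y \<longleftrightarrow> w = y \<or> (\<forall>z\<in>?D. d w y < d w z)" if w: "w \<in> pverts H" for w
  proof
    assume best: "best w = y"
    have "d w y < d w z" if "z \<in> ?D" for z
    proof -
      have "d w y \<le> d w z" using best_le[of z w] best X that by simp
      moreover have "d w y \<noteq> d w z"
        using inj_dist[OF w] y D that yD by (metis inj_onD subsetD)
      ultimately show ?thesis by simp
    qed
    then show "w = y \<or> (\<forall>z\<in>?D. d w y < d w z)" by blast
  next
    assume "w = y \<or> (\<forall>z\<in>?D. d w y < d w z)"
    then show "best w = y"
    proof
      assume "w = y"
      then show ?thesis using best_egress[of y] X by simp
    next
      assume "\<forall>z\<in>?D. d w y < d w z"
      then show ?thesis using w X by (intro arg_min_eqI) (auto simp: less_imp_le)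
    qed
  qed
  then have "best w = y \<longleftrightarrow> w \<in> S_set (pverts H) d x y" if "w \<in> pverts H" for w
    using less_iff that by (auto simp: S_set_def)
  moreover have "S_set (pverts H) d x y \<subseteq> pverts H" using y by (auto simp: S_set_def)
  ultimately show ?thesis by blast
qed

text \<open>All other egress routers are farther from \<open>r\<close> than \<open>best r\<close>,
  hence lie in \<open>D(r, best r)\<close>, and members of \<open>S\<close> are closer to
  \<open>best r\<close> than to that set, \<open>best r\<close> itself aside.\<close>

lemma (in egress) S_set_subset_cell:
  assumes r: "r \<in> pverts H"
  shows "S_set (pverts H) d r (best r) \<subseteq> {w \<in> pverts H. best w = best r}"
proof
  fix w assume w: "w \<in> S_set (pverts H) d r (best r)"
  have bX: "best r \<in> X" "best r \<in> pverts H" using best_in egress by auto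
  show "w \<in> {w \<in> pverts H. best w = best r}"
  proof (cases "w = best r")
    case True
    then show ?thesis using bX best_egress[of "best r"] by simp
  next
    case False
    with w have w: "w \<in> pverts H" "d w (best r) < dist_to_set d w (D_set (pverts H) d r (best r))"
      by (auto simp: S_set_def)
    have "d w (best r) \<le> d w z" if z: "z \<in> X" for z
    proof (cases "z = best r")
      case False
      have "d r (best r) \<noteq> d r z"
        using inj_dist[OF r] bX z egress False by (metis inj_onD subsetD)
      then have "z \<in> D_set (pverts H) d r (best r)"
        using best_le[OF z, of r] z egress by (auto simp: D_set_def)
      then have "dist_to_set d w (D_set (pverts H) d r (best r)) \<le> d w z"
        unfolding dist_to_set_def by (rule INF_lower)
      then show ?thesis using w(2) by order
    qed simp
    then show ?thesis using w(1) bX by (auto intro!: arg_min_eqI)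
  qed
qed

lemma (in pair_graph) correct_iff_signaling_paths:
  fixes d :: "'a \<Rightarrow> 'a \<Rightarrow> ereal"
  assumes inj_dist: "\<And>r. r \<in> pverts G \<Longrightarrow> inj_on (d r) (pverts G)"
    and self_closest: "\<And>r z. \<lbrakk>r \<in> pverts G; z \<in> pverts G; r \<noteq> z\<rbrakk> \<Longrightarrow> d r r < d r z"
    and finite_dist: "\<And>r z. \<lbrakk>r \<in> pverts G; z \<in> pverts G\<rbrakk> \<Longrightarrow> d r z < \<infinity>"
  shows "correct d G \<longleftrightarrow> (\<forall>x\<in>pverts G. \<forall>y\<in>pverts G. \<exists>p. apath y p x \<and>
    set (awalk_verts y p) \<subseteq> S_set (pverts G) d x y)" (is "_ \<longleftrightarrow> ?paths")
proof
  have egress: "egress G d X" if "X \<subseteq> pverts G" "X \<noteq> {}" for X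
    using that inj_dist self_closest by unfold_locales auto
  assume correct: "correct d G"
  show ?paths
  proof (intro ballI)
    fix x y assume xy: "x \<in> pverts G" "y \<in> pverts G"
    define X where "X = insert y (D_set (pverts G) d x y)"
    have X: "X \<subseteq> pverts G" "X \<noteq> {}" using xy by (auto simp: X_def D_set_def)
    interpret egress G d X using egress[OF X] .
    have cell: "S_set (pverts G) d x y = {w \<in> pverts G. best w = y}"
      using cell_eq_S_set[OF xy(2) X_def finite_dist[OF _ xy(2)]] .
    \<comment> \<open>Every other member of \<open>X\<close> lies in \<open>D(x, y)\<close> and is
      thus farther from \<open>x\<close>.\<close>
    have "best x = y"
      by (rule arg_min_eqI[OF xy(1)]) (auto simp: X_def D_set_def)
    then have path: "(y, x) \<in> cell_arcs\<^sup>*"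
      using cells_connected_if_complete_visibility[of x] correct X xy by (auto simp: correct_def)
    define S where "S = S_set (pverts G) d x y"
    note cell_S = cell[folded S_def]
    from path have "(y, x) \<in> {(u, v) \<in> parcs G. u \<in> S \<and> v \<in> S}\<^sup>*"
    proof (induction rule: rtrancl_induct)
      case (step u v)
      have "best u = y" using cell_path_best[OF step(1)] best_egress[of y] by (simp add: X_def)
      then have "(u, v) \<in> {(u, v) \<in> parcs G. u \<in> S \<and> v \<in> S}"
        unfolding cell_S using step(2) cell_arcs_in_verts[OF step(2)]
        by (auto simp: cell_arcs_def)
      with step.IH show ?case by (rule rtrancl_into_rtrancl)
    qed simp
    moreover have "y \<in> S" by (simp add: S_def S_set_def)
    ultimately show "\<exists>p. apath y p x \<and> set (awalk_verts y p) \<subseteq> S_set (pverts G) d x y"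
      using apath_in_set_iff[OF xy(2)] by (simp add: S_def)
  qed
next
  assume paths: ?paths
  show "correct d G" unfolding correct_def
  proof (intro allI impI)
    fix X assume X: "X \<subseteq> pverts G"
    show "complete_visibility d G X"
    proof (cases "X = {}")
      case False
      interpret egress G d X using X False inj_dist self_closest by unfold_locales auto
      show ?thesis
      proof (rule complete_visibility_if_cells_connected)
        fix r assume r: "r \<in> pverts G"
        let ?S = "S_set (pverts G) d r (best r)"
        have b: "best r \<in> pverts G" using best_in X by blast
        have "(best r, r) \<in> {(u, v) \<in> parcs G. u \<in> ?S \<and> v \<in> ?S}\<^sup>*"
          using paths r b apath_in_set_iff[OF b] by blast
        moreover have "{(u, v) \<in> parcs G. u \<in> ?S \<and> v \<in> ?S} \<subseteq> cell_arcs"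
        proof clarify
          fix u v assume "(u, v) \<in> parcs G" "u \<in> ?S" "v \<in> ?S"
          moreover from this have "best u = best r" "best v = best r"
            using S_set_subset_cell[OF r] by blast+
          ultimately show "(u, v) \<in> cell_arcs" by (simp add: cell_arcs_def)
        qed
        ultimately show "(best r, r) \<in> cell_arcs\<^sup>*" using rtrancl_mono by blast
      qed
    qed (simp add: complete_visibility_no_egress)
  qed
qed

section \<open>Shortest-path distances in the physical network\<close>

text \<open>The empty walk bounds the distance from \<open>u\<close> to itself by 0, while the
  distance to \<open>v\<close> is attained by a nonempty path of positive cost.\<close>

lemma (in fin_digraph) mu_self_less:
  assumes "\<And>e. e \<in> arcs G \<Longrightarrow> c e > 0" "u \<in> verts G" "u \<rightarrow>\<^sup>* v" "u \<noteq> v"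
  shows "\<mu> c u u < \<mu> c u v"
proof -
  have pos: "awalk_cost c p > 0" if "set p \<subseteq> arcs G" "p \<noteq> []" for p
    using that
  proof (induction p)
    case (Cons e p)
    then show ?case using assms(1)[of e] by (cases "p = []") auto
  qed simp
  obtain p where p: "apath u p v" "\<mu> c u v = awalk_cost c p"
    using min_cost_awalk[OF assms(3), of c] assms(1) less_imp_le by blast
  then have "p \<noteq> []" "set p \<subseteq> arcs G"
    using assms(4) by (auto simp: apath_def awalk_Nil_iff awalk_def)
  moreover have "\<mu> c u u \<le> 0"
    using min_cost_le_walk_cost[of u "[]" u c] assms(2) by (simp add: awalk_Nil_iff zero_ereal_def)
  ultimately show ?thesis using pos[of p] p(2) by (metis ereal_less(2) le_less_trans)
qed

theorem theorem1:
  fixes V :: "'v set"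
    and G H :: "'v pair_pre_digraph"
    and weight :: "('v \<times> 'v) weight_fun"
    and d :: "'v \<Rightarrow> 'v \<Rightarrow> ereal"
  assumes physical_network: "pair_graph G" "connected (with_proj G)"
    and positive_weights: "\<And>u v. (u, v) \<in> parcs G \<Longrightarrow> weight (u, v) > 0"
    and symmetric_weights: "\<And>u v. (u, v) \<in> parcs G \<Longrightarrow> weight (u, v) = weight (v, u)"
    and routers: "V \<subseteq> pverts G"
    and distance: "d = wf_digraph.\<mu> (with_proj G) weight"
    and no_ties: "distinct_distances V d"
    and signaling_graph: "pair_graph H" "pverts H = V"
  shows "correct d H \<longleftrightarrow>
    (\<forall>x\<in>V. \<forall>y\<in>V. \<exists>p. pre_digraph.apath (with_proj H) y p x \<and>
       set (pre_digraph.awalk_verts (with_proj H) y p) \<subseteq> S_set V d x y)"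
proof -
  interpret G: pair_graph G by (rule physical_network)
  interpret H: pair_graph H by (rule signaling_graph)
  have reach: "u \<rightarrow>\<^sup>*\<^bsub>with_proj G\<^esub> v" if "u \<in> pverts G" "v \<in> pverts G" for u v
    using G.symmetric_connected_imp_strongly_connected[OF G.sym_arcs physical_network(2)] that
    by (auto elim: strongly_connectedE)
  have self: "d r r < d r z" if "r \<in> V" "z \<in> V" "r \<noteq> z" for r z
    unfolding distance
    using positive_weights that reach subsetD[OF routers] by (intro G.mu_self_less) auto
  have "inj_on (d r) V" if r: "r \<in> V" for r
  proof (rule inj_onI)
    fix y z assume yz: "y \<in> V" "z \<in> V" "d r y = d r z"
    show "y = z"
    \<comment> \<open>\<open>distinct_distances\<close> compares only pairs of distinct routers, so
      the distance from \<open>r\<close> to itself is separated from the others by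
      \<open>self\<close>.\<close>
    proof (cases "r = y \<or> r = z")
      case True
      then show ?thesis using self[of r] yz r by force
    next
      case False
      then have "{r, y} = {r, z}" using no_ties r yz unfolding distinct_distances_def by blast
      then show ?thesis by (auto simp: doubleton_eq_iff)
    qed
  qed
  moreover note self
  moreover have "d r z < \<infinity>" if "r \<in> V" "z \<in> V" for r z
    unfolding distance using G.\<mu>_reach_conv reach routers that by blast
  ultimately show ?thesis
    using H.correct_iff_signaling_paths[of d] unfolding signaling_graph(2) by simp
qed

end
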